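(* Let $A\in\mathbb{C}^{n\times n}$ be weakly stochastic and power nonnegative. Then $1=\rho(A)\in\sigma(A)$. Moreover, if $A^m$ is nonnegative and irreducible for some $m\ge\nu(A)$, then the following hold with $y=e$ as left eigenvector, i.e. $y^{T}A=\lambda_1(A)y^{T}$ for $y=e$: (ii) $\lambda_1(A)$ is simple and nonzero, and $\rho(A)\in\sigma(A)$ if and only if $\lambda_1(A)=\rho(A)$. (iii) The right eigenvector $x$ of $A$ relative to $\lambda_1(A)$ can be chosen positive, and the right eigenvector $x$ and the left eigenvector $y=e$ are unique up to a scalar multiple. (iv) If $\nu(A)$ and $m$ are coprime, then $\rho(A)\in\sigma(A)$. If $\rho(A)\notin\sigma(A)$ and $\nu(A)$ or $m$ is prime, then $\nu(A)$ is the least positive integer for which $A^{\nu(A)}$ is nonnegative and irreducible. (v) $\lambda_1(A)^{-1}A$ is similar to a power nonnegative weakly column stochastic matrix $C$ and to a power nonnegative weakly row stochastic matrix $R$, both having the same pattern as $A$ and such that $\nu(C)=\nu(R)=\nu(A)$. (vi) If $\lambda\in\sigma(A)$ is such that $|\lambda|=\rho(A)$, then $\lambda=\rho(A)\exp\left(\frac{2\pi\mathbf{i}h}{pm}\right)$ for some integer $h$ with $1\le h\le pm$, where $p$ is the cardinality of $\{\lambda\in\sigma(A):|\lambda|=\rho(A)\}$. (vii) If $(A^m)_{ii}>0$ for some $i$, then $|\lambda_1(A)|>|\lambda_2(A)|$.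
   Context: $e=(1,\dots,1)^{T}$. A complex square matrix $A$ is weakly stochastic (= weakly column stochastic) if $A^{T}e=e$, and weakly row stochastic if $Ae=e$ (no nonnegativity required). $\sigma(A)$ is the spectrum and $\rho(A)$ the spectral radius; $\mathbf{i}$ is the imaginary unit. $M\ge O$ (nonnegative), respectively $M>O$ (positive), means that all entries are real and $\ge0$, respectively $>0$; similarly for vectors. $A$ is power nonnegative if $A^k\ge O$ for some integer $k\ge1$, and then $\nu(A)=\min\{k\ge1:A^k\ge O\}$. The distinct eigenvalues of $A$ are listed as $\lambda_1(A),\dots,\lambda_s(A)$ with $\rho(A)=|\lambda_1(A)|\ge|\lambda_2(A)|\ge\dots\ge|\lambda_s(A)|$, where, when $A^m$ is nonnegative and irreducible, $\lambda_1(A)$ is the eigenvalue $\lambda$ of modulus $\rho(A)$ with $\lambda^m=\rho(A)^m$ (there is exactly one); (vii) is vacuous if $s=1$. Two matrices have the same pattern if their nonzero entries are in the same positions. A square matrix $A$ is reducible if there is a permutation matrix $P$ such that $PAP^{T}=\begin{pmatrix} X & O \\ W & Y \end{pmatrix}$ with square diagonal blocks; otherwise it is irreducible. *)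

theory Defs
  imports "Jordan_Normal_Form.Spectral_Radius" "HOL-Computational_Algebra.Primes"
begin

text \<open>The order on type complex is the one of Complex_Order: \<open>0 \<le> z\<close> (\<open>0 < z\<close>) says that \<open>z\<close> is
  real and nonnegative (positive). Its pointwise lifting \<open>\<le>\<close> to matrices also compares
  the dimensions. The lifted strict order \<open><\<close> is \<open>\<le>\<close> together with inequality, not entrywise
  positivity, hence the separate notion \<open>positive_vec\<close>.\<close>

definition nonneg_mat :: "complex mat \<Rightarrow> bool" where
  "nonneg_mat A \<longleftrightarrow> 0\<^sub>m (dim_row A) (dim_col A) \<le> A"

definition positive_vec :: "complex vec \<Rightarrow> bool" where
  "positive_vec v \<longleftrightarrow> (\<forall>i < dim_vec v. 0 < v $ i)"

definition ones_vec :: "nat \<Rightarrow> complex vec" where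
  "ones_vec n = vec n (\<lambda>_. 1)"

definition weakly_row_stochastic :: "complex mat \<Rightarrow> bool" where
  "weakly_row_stochastic A \<longleftrightarrow>
     square_mat A \<and> A *\<^sub>v ones_vec (dim_row A) = ones_vec (dim_row A)"

definition weakly_stochastic :: "complex mat \<Rightarrow> bool" where
  "weakly_stochastic A \<longleftrightarrow>
     square_mat A \<and> transpose_mat A *\<^sub>v ones_vec (dim_row A) = ones_vec (dim_row A)"

definition power_nonneg :: "complex mat \<Rightarrow> bool" where
  "power_nonneg A \<longleftrightarrow> square_mat A \<and> (\<exists>k\<ge>1. nonneg_mat (A ^\<^sub>m k))"

text \<open>Only meaningful if \<open>power_nonneg A\<close> holds.\<close>

definition nu :: "complex mat \<Rightarrow> nat" where
  "nu A = (LEAST k. k \<ge> 1 \<and> nonneg_mat (A ^\<^sub>m k))"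

definition permutation_mat :: "nat \<Rightarrow> complex mat \<Rightarrow> bool" where
  "permutation_mat n P \<longleftrightarrow>
     (\<exists>p. p permutes {..<n} \<and> P = mat n n (\<lambda>(i, j). if j = p i then 1 else 0))"

text \<open>Both diagonal blocks are nonempty, so every \<open>1 \<times> 1\<close> matrix is irreducible.\<close>

definition reducible_mat :: "complex mat \<Rightarrow> bool" where
  "reducible_mat A \<longleftrightarrow>
     (\<exists>k l P X W Y. 0 < k \<and> 0 < l \<and> A \<in> carrier_mat (k + l) (k + l) \<and>
        permutation_mat (k + l) P \<and>
        X \<in> carrier_mat k k \<and> W \<in> carrier_mat l k \<and> Y \<in> carrier_mat l l \<and>
        P * A * transpose_mat P = four_block_mat X (0\<^sub>m k l) W Y)"

definition irreducible_mat :: "complex mat \<Rightarrow> bool" where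
  "irreducible_mat A \<longleftrightarrow> square_mat A \<and> \<not> reducible_mat A"

definition same_pattern :: "complex mat \<Rightarrow> complex mat \<Rightarrow> bool" where
  "same_pattern A B \<longleftrightarrow> dim_row A = dim_row B \<and> dim_col A = dim_col B \<and>
     (\<forall>i < dim_row A. \<forall>j < dim_col A. A $$ (i, j) \<noteq> 0 \<longleftrightarrow> B $$ (i, j) \<noteq> 0)"

definition simple_eigenvalue :: "complex mat \<Rightarrow> complex \<Rightarrow> bool" where
  "simple_eigenvalue A l \<longleftrightarrow> order l (char_poly A) = 1"

text \<open>\<open>\<lambda>\<^sub>1(A)\<close>; the description is unique whenever \<open>A ^\<^sub>m m\<close> is nonnegative and irreducible.\<close>

definition lambda1 :: "complex mat \<Rightarrow> nat \<Rightarrow> complex" where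
  "lambda1 A m = (THE l. l \<in> spectrum A \<and> cmod l = spectral_radius A \<and>
                         l ^ m = complex_of_real (spectral_radius A) ^ m)"

text \<open>The list \<open>\<lambda>\<^sub>1(A), \<dots>, \<lambda>\<^sub>s(A)\<close>, indexed from 0. Ties in modulus may be broken
  arbitrarily except that \<open>\<lambda>\<^sub>1(A)\<close> is prescribed.\<close>

definition eigenvalue_listing :: "complex mat \<Rightarrow> nat \<Rightarrow> complex list \<Rightarrow> bool" where
  "eigenvalue_listing A m ls \<longleftrightarrow> distinct ls \<and> set ls = spectrum A \<and>
     sorted_wrt (\<lambda>a b. cmod a \<ge> cmod b) ls \<and> ls \<noteq> [] \<and> ls ! 0 = lambda1 A m"

end

theory Submission
  imports Defs
begin

text \<open>
Since the columns of \<open>A\<close> sum to 1, the vector \<open>e\<close> of ones is a left eigenvector for 1; and since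
a nonnegative matrix with unit column sums has no eigenvalue outside the closed unit disc, applying
this to a nonnegative power of \<open>A\<close> gives \<open>\<rho>(A) = 1\<close>, and 1 is an eigenvalue
(\<open>spectral_radius_weakly_stochastic\<close>).

Let \<open>B = A\<^sup>m\<close> be nonnegative and irreducible. Everything else rests on how \<open>B\<close> acts on an
eigenvector \<open>v\<close> whose eigenvalue \<open>\<mu>\<close> has modulus 1. Pairing \<open>\<bar>v\<bar> \<le> B \<bar>v\<bar>\<close> with \<open>e\<close> shows
\<open>B \<bar>v\<bar> = \<bar>v\<bar>\<close>; by irreducibility \<open>v\<close> has no zero entry (\<open>eigenfun_nonzero\<close>); so the eigenspaces
for such \<open>\<mu>\<close> are lines (\<open>eigenfun_unique\<close>); and the equality case of the triangle inequality gives
\<open>B D = \<mu> D B\<close> for the diagonal matrix \<open>D\<close> of the phases of \<open>v\<close> (\<open>eigenfun_phase\<close>).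

An eigenvector of \<open>A\<close> for \<open>l\<close> is one of \<open>B\<close> for \<open>l\<^sup>m\<close>. As the eigenspaces of \<open>B\<close> are lines,
\<open>l \<mapsto> l\<^sup>m\<close> is injective on the eigenvalues of \<open>A\<close> of modulus 1. Therefore \<open>\<lambda>\<^sub>1(A) = 1\<close>, its
eigenspace is spanned by a positive vector \<open>x\<close>, and the same argument for the transpose, with
\<open>x\<close> in place of \<open>e\<close>, makes the left eigenspace the line through \<open>e\<close>; this gives (iii).
The eigenvalue is algebraically simple because \<open>e\<^sup>T x \<noteq> 0\<close>, as (ii) requires. Both implications
in (iv) follow from \<open>\<rho>(A) \<in> \<sigma>(A)\<close>. For (v) conjugate \<open>A\<close> by the diagonal matrix of \<open>x\<close>.
For (vi), \<open>B D = \<mu> D B\<close> shows that the peripheral eigenvalues of \<open>B\<close> are permuted by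
multiplication with \<open>\<mu>\<close>, so \<open>\<mu>\<close> to the number of these is 1, and that number is the same for
\<open>A\<close> and \<open>B\<close> (\<open>peripheral_power_eq_1\<close>). For (vii), a positive diagonal entry of \<open>B\<close> forces
\<open>\<mu> = 1\<close> in \<open>B D = \<mu> D B\<close> (\<open>diagonal_entry_pos_imp\<close>).
\<close>

section \<open>Two elementary facts\<close>

text \<open>The equality case of the triangle inequality. After multiplication by \<open>cnj c\<close> the real parts of
the terms already add up to the sum of their moduli, so each term is its own modulus.\<close>
lemma sum_aligned:
  fixes z :: "'i \<Rightarrow> complex"
  assumes "finite J" "cmod c = 1" "j \<in> J"
    and eq: "(\<Sum>j\<in>J. z j) = c * of_real (\<Sum>j\<in>J. cmod (z j))"
  shows "z j = c * of_real (cmod (z j))"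
proof -
  have cc: "cnj c * c = 1"
    using assms(2) complex_norm_square[of c] by (simp add: mult.commute)
  have "(\<Sum>j\<in>J. Re (cnj c * z j)) = Re (cnj c * (\<Sum>j\<in>J. z j))"
    by (simp only: sum_distrib_left Re_sum)
  also have "\<dots> = Re (cnj c * c * of_real (\<Sum>j\<in>J. cmod (z j)))"
    by (simp only: eq mult.assoc)
  also have "\<dots> = (\<Sum>j\<in>J. cmod (z j))"
    by (simp only: cc mult_1 Re_complex_of_real)
  finally have "(\<Sum>j\<in>J. cmod (z j) - Re (cnj c * z j)) = 0"
    by (simp only: sum_subtractf diff_self)
  moreover have le: "Re (cnj c * z j) \<le> cmod (z j)" for j
    using complex_Re_le_cmod[of "cnj c * z j"] assms(2) by (simp add: norm_mult)
  ultimately have "cmod (z j) - Re (cnj c * z j) = 0"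
    using assms(1,3) by (subst (asm) sum_nonneg_eq_0_iff) auto
  moreover have "cmod (cnj c * z j) = cmod (z j)"
    using assms(2) by (simp add: norm_mult)
  ultimately have *: "cnj c * z j = of_real (cmod (z j))"
    using cmod_eq_Re complex_eq_iff cmod_power2[of "cnj c * z j"] by (auto simp: complex_eq_iff)
  have "z j = c * (cnj c * z j)"
    using cc by (simp add: mult.commute mult.left_commute)
  then show ?thesis
    by (simp only: *)
qed

text \<open>Multiplication by \<open>c\<close> permutes \<open>Q\<close>, so the product of all elements of \<open>Q\<close> is equal to
\<open>c ^ card Q\<close> times itself.\<close>
lemma power_card_eq_1:
  fixes c :: "'a :: field"
  assumes "finite Q" "0 \<notin> Q" "c \<noteq> 0" "\<And>q. q \<in> Q \<Longrightarrow> c * q \<in> Q"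
  shows "c ^ card Q = 1"
proof -
  have "inj_on ((*) c) Q"
    using assms(3) by (auto intro!: inj_onI)
  moreover from this have "(*) c ` Q = Q"
    using assms by (intro endo_inj_surj) auto
  ultimately have "prod id Q = (\<Prod>q\<in>Q. c * q)"
    using prod.reindex[of "(*) c" Q id] by simp
  also have "\<dots> = c ^ card Q * prod id Q"
    by (simp add: prod.distrib)
  finally show ?thesis
    using assms(1,2) by auto
qed

section \<open>Perron--Frobenius theory on the unit circle\<close>

text \<open>A nonnegative matrix \<open>b\<close> with a positive left eigenvector \<open>w\<close> for the eigenvalue 1, over an
arbitrary finite index set. Irreducibility says that no proper nonempty set of indices is closed,
which is the form in which it is used and which passes to the transpose by taking complements.
Both a column stochastic matrix (with \<open>w = 1\<close>) and its transpose (with \<open>w\<close> the Perron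
vector) are instances, so the results below apply to right and to left eigenvectors alike.\<close>
locale irreducible_kernel =
  fixes I :: "'i set" and b :: "'i \<Rightarrow> 'i \<Rightarrow> real" and w :: "'i \<Rightarrow> real"
  assumes finite_index: "finite I"
    and kernel_nonneg: "i \<in> I \<Longrightarrow> j \<in> I \<Longrightarrow> 0 \<le> b i j"
    and irreducible:
      "Z \<subseteq> I \<Longrightarrow> Z \<noteq> {} \<Longrightarrow> (\<And>i j. i \<in> Z \<Longrightarrow> j \<in> I - Z \<Longrightarrow> b i j = 0) \<Longrightarrow> Z = I"
    and weight_pos: "i \<in> I \<Longrightarrow> 0 < w i"
    and weight_left: "j \<in> I \<Longrightarrow> (\<Sum>i\<in>I. w i * b i j) = w j"
begin

definition eigenfun :: "complex \<Rightarrow> ('i \<Rightarrow> complex) \<Rightarrow> bool" where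
  "eigenfun \<mu> v \<longleftrightarrow> (\<forall>i\<in>I. (\<Sum>j\<in>I. of_real (b i j) * v j) = \<mu> * v i)"

text \<open>The triangle inequality gives \<open>\<bar>v\<bar> \<le> b \<bar>v\<bar>\<close> entrywise. Pairing with the positive left
eigenvector \<open>w\<close> makes the two sides equal, so no entry can be strictly smaller.\<close>
lemma eigenfun_cmod:
  assumes v: "eigenfun \<mu> v" and \<mu>: "cmod \<mu> = 1" and i: "i \<in> I"
  shows "(\<Sum>j\<in>I. b i j * cmod (v j)) = cmod (v i)"
proof -
  (* d is the defect in the entrywise inequality. *)
  define d where "d i = (\<Sum>j\<in>I. b i j * cmod (v j)) - cmod (v i)" for i
  have d_nonneg: "0 \<le> d i" if "i \<in> I" for i
  proof -
    have "cmod (v i) = cmod (\<mu> * v i)"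
      by (simp add: norm_mult \<mu>)
    also have "\<dots> = cmod (\<Sum>j\<in>I. of_real (b i j) * v j)"
      using v that by (simp add: eigenfun_def)
    also have "\<dots> \<le> (\<Sum>j\<in>I. cmod (of_real (b i j) * v j))"
      by (rule norm_sum)
    also have "\<dots> = (\<Sum>j\<in>I. b i j * cmod (v j))"
      using that by (intro sum.cong) (auto simp: norm_mult kernel_nonneg)
    finally show ?thesis
      by (simp add: d_def)
  qed
  have "(\<Sum>i\<in>I. w i * (\<Sum>j\<in>I. b i j * cmod (v j))) = (\<Sum>j\<in>I. (\<Sum>i\<in>I. w i * b i j) * cmod (v j))"
    by (simp add: sum_distrib_left sum_distrib_right mult.assoc) (rule sum.swap)
  also have "\<dots> = (\<Sum>j\<in>I. w j * cmod (v j))"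
    by (simp add: weight_left)
  finally have "(\<Sum>i\<in>I. w i * d i) = 0"
    by (simp add: d_def right_diff_distrib sum_subtractf)
  then have "w i * d i = 0"
    using i finite_index d_nonneg weight_pos
    by (subst (asm) sum_nonneg_eq_0_iff) (auto intro: mult_nonneg_nonneg less_imp_le)
  then show ?thesis
    using weight_pos[OF i] by (simp add: d_def)
qed

text \<open>By \<open>eigenfun_cmod\<close> the zero set of \<open>v\<close> is closed: a row sum \<open>\<Sum>j. b i j \<bar>v j\<bar>\<close> that vanishes forces
\<open>b i j = 0\<close> wherever \<open>v j \<noteq> 0\<close>. Irreducibility leaves only the empty zero set.\<close>
lemma eigenfun_nonzero:
  assumes v: "eigenfun \<mu> v" and \<mu>: "cmod \<mu> = 1" and ne: "\<exists>i\<in>I. v i \<noteq> 0"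
    and i: "i \<in> I"
  shows "v i \<noteq> 0"
proof
  assume "v i = 0"
  define Z where "Z = {i \<in> I. v i = 0}"
  have "Z = I"
  proof (rule irreducible)
    show "Z \<subseteq> I" "Z \<noteq> {}"
      using i \<open>v i = 0\<close> by (auto simp: Z_def)
    fix k j assume k: "k \<in> Z" and j: "j \<in> I - Z"
    have "(\<Sum>j\<in>I. b k j * cmod (v j)) = 0"
      using eigenfun_cmod[OF v \<mu>, of k] k by (auto simp: Z_def)
    then have "b k j * cmod (v j) = 0"
      using finite_index k j by (subst (asm) sum_nonneg_eq_0_iff) (auto simp: Z_def kernel_nonneg)
    then show "b k j = 0"
      using j by (auto simp: Z_def)
  qed
  then show False
    using ne by (auto simp: Z_def)
qed

text \<open>Subtract the multiple of \<open>v\<close> that agrees with \<open>u\<close> in one coordinate: the difference vanishes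
there, hence everywhere.\<close>
lemma eigenfun_unique:
  assumes v: "eigenfun \<mu> v" and u: "eigenfun \<mu> u" and \<mu>: "cmod \<mu> = 1"
    and ne: "\<exists>i\<in>I. v i \<noteq> 0"
  obtains c where "\<And>i. i \<in> I \<Longrightarrow> u i = c * v i"
proof -
  from ne obtain k where k: "k \<in> I" "v k \<noteq> 0"
    by blast
  define c where "c = u k / v k"
  define z where "z i = u i - c * v i" for i
  have "eigenfun \<mu> z"
    unfolding eigenfun_def
  proof
    fix i assume i: "i \<in> I"
    have "(\<Sum>j\<in>I. of_real (b i j) * z j)
        = (\<Sum>j\<in>I. of_real (b i j) * u j) - c * (\<Sum>j\<in>I. of_real (b i j) * v j)"
      by (simp add: z_def right_diff_distrib sum_subtractf sum_distrib_left mult.left_commute)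
    then show "(\<Sum>j\<in>I. of_real (b i j) * z j) = \<mu> * z i"
      using u v i by (simp add: eigenfun_def z_def algebra_simps)
  qed
  moreover have "z k = 0"
    using k by (simp add: z_def c_def)
  ultimately have "\<forall>i\<in>I. z i = 0"
    using eigenfun_nonzero[of \<mu> z k] \<mu> k by blast
  then have "u i = c * v i" if "i \<in> I" for i
    using that by (simp add: z_def)
  then show thesis
    by (rule that)
qed

text \<open>With \<open>D\<close> the diagonal matrix of the phases \<open>sgn (v i)\<close> this is Wielandt's identity
\<open>b D = \<mu> D b\<close>. It holds because \<open>\<mu> v\<^sub>i = \<Sum>j. b i j v\<^sub>j\<close> is an equality case of the triangle
inequality, so that all terms share the phase of \<open>\<mu> v\<^sub>i\<close>.\<close>
lemma eigenfun_phase: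
  assumes v: "eigenfun \<mu> v" and \<mu>: "cmod \<mu> = 1" and ne: "\<exists>i\<in>I. v i \<noteq> 0"
    and i: "i \<in> I" and j: "j \<in> I"
  shows "of_real (b i j) * sgn (v j) = \<mu> * sgn (v i) * of_real (b i j)"
proof -
  have nz: "v i \<noteq> 0" "v j \<noteq> 0"
    using eigenfun_nonzero[OF v \<mu> ne] i j by auto
  have norm: "cmod (of_real (b i j) * v j) = b i j * cmod (v j)" if "j \<in> I" for j
    using i that by (simp add: norm_mult kernel_nonneg)
  have "(\<Sum>j\<in>I. of_real (b i j) * v j) = \<mu> * v i"
    using v i by (simp add: eigenfun_def)
  also have "\<dots> = \<mu> * sgn (v i) * of_real (cmod (v i))"
    using nz by (simp add: sgn_eq)
  also have "cmod (v i) = (\<Sum>j\<in>I. cmod (of_real (b i j) * v j))"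
    using eigenfun_cmod[OF v \<mu> i] by (simp add: norm cong: sum.cong)
  finally have "of_real (b i j) * v j = \<mu> * sgn (v i) * of_real (cmod (of_real (b i j) * v j))"
    using \<mu> nz j by (intro sum_aligned[OF finite_index]) (simp_all add: norm_mult norm_sgn)
  then have "of_real (b i j) * v j = \<mu> * sgn (v i) * of_real (b i j * cmod (v j))"
    by (simp only: norm[OF j])
  then have "of_real (b i j) * v j / of_real (cmod (v j)) = \<mu> * sgn (v i) * of_real (b i j)"
    using nz by (simp add: field_simps)
  then show ?thesis
    by (simp add: sgn_eq)
qed

text \<open>By \<open>b D = \<mu> D b\<close>, the map \<open>u \<mapsto> D u\<close> multiplies eigenvalues by \<open>\<mu>\<close>. This is what makes the
eigenvalues of modulus 1 closed under multiplication.\<close>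
lemma eigenfun_twist:
  assumes v: "eigenfun \<mu> v" "cmod \<mu> = 1" "\<exists>i\<in>I. v i \<noteq> 0"
    and u: "eigenfun \<nu> u"
  shows "eigenfun (\<mu> * \<nu>) (\<lambda>i. sgn (v i) * u i)"
  unfolding eigenfun_def
proof
  fix i assume i: "i \<in> I"
  have "(\<Sum>j\<in>I. of_real (b i j) * (sgn (v j) * u j))
      = (\<Sum>j\<in>I. \<mu> * sgn (v i) * (of_real (b i j) * u j))"
    using eigenfun_phase[OF v i]
    by (intro sum.cong refl) (metis (no_types, lifting) mult.assoc)
  also have "\<dots> = \<mu> * sgn (v i) * (\<nu> * u i)"
    using u i by (simp add: eigenfun_def flip: sum_distrib_left)
  finally show "(\<Sum>j\<in>I. of_real (b i j) * (sgn (v j) * u j)) = \<mu> * \<nu> * (sgn (v i) * u i)"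
    by (simp add: ac_simps)
qed

lemma eigenfun_positive:
  assumes v: "eigenfun 1 v" and ne: "\<exists>i\<in>I. v i \<noteq> 0"
  obtains c where "\<And>i. i \<in> I \<Longrightarrow> c * v i = of_real (cmod (v i))"
proof -
  have "eigenfun 1 (\<lambda>i. of_real (cmod (v i)))"
    using eigenfun_cmod[OF v] by (auto simp: eigenfun_def simp flip: of_real_mult of_real_sum)
  from eigenfun_unique[OF v this _ ne] obtain c
    where "\<And>i. i \<in> I \<Longrightarrow> of_real (cmod (v i)) = c * v i" by auto
  then show thesis
    by (intro that[of c]) simp
qed

end

section \<open>Entrywise descriptions and weakly stochastic matrices\<close>

lemma nonneg_mat_iff:
  assumes "B \<in> carrier_mat n n"
  shows "nonneg_mat B \<longleftrightarrow> (\<forall>i<n. \<forall>j<n. 0 \<le> B $$ (i, j))"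
  using assms by (auto simp: nonneg_mat_def less_eq_mat_def)

lemma mult_mat_vec_nth:
  assumes "B \<in> carrier_mat n n" "v \<in> carrier_vec n" "i < n"
  shows "(B *\<^sub>v v) $ i = (\<Sum>j<n. B $$ (i, j) * v $ j)"
  using assms by (auto simp: scalar_prod_def lessThan_atLeast0 intro!: sum.cong)

lemma mult_mat_nth:
  assumes "B \<in> carrier_mat n n" "C \<in> carrier_mat n n" "i < n" "j < n"
  shows "(B * C) $$ (i, j) = (\<Sum>k<n. B $$ (i, k) * C $$ (k, j))"
  using assms by (auto simp: scalar_prod_def lessThan_atLeast0 intro!: sum.cong)

lemma eigenvector_iff_nth:
  assumes "B \<in> carrier_mat n n"
  shows "eigenvector B v \<mu> \<longleftrightarrow> v \<in> carrier_vec n \<and> (\<exists>i<n. v $ i \<noteq> 0) \<and>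
    (\<forall>i<n. (\<Sum>j<n. B $$ (i, j) * v $ j) = \<mu> * v $ i)"
proof (cases "v \<in> carrier_vec n")
  case True
  have "v \<noteq> 0\<^sub>v n \<longleftrightarrow> (\<exists>i<n. v $ i \<noteq> 0)"
    using True by (auto simp: vec_eq_iff)
  moreover have "B *\<^sub>v v = \<mu> \<cdot>\<^sub>v v \<longleftrightarrow> (\<forall>i<n. (B *\<^sub>v v) $ i = \<mu> * v $ i)"
    using True assms by (auto simp: vec_eq_iff simp del: index_mult_mat_vec)
  ultimately show ?thesis
    using True assms by (simp add: eigenvector_def mult_mat_vec_nth del: index_mult_mat_vec)
next
  case False
  with assms show ?thesis
    by (simp add: eigenvector_def)
qed

lemma weakly_stochastic_iff:
  assumes "B \<in> carrier_mat n n"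
  shows "weakly_stochastic B \<longleftrightarrow> (\<forall>j<n. (\<Sum>i<n. B $$ (i, j)) = 1)"
proof -
  have T: "transpose_mat B \<in> carrier_mat n n" and e: "ones_vec n \<in> carrier_vec n"
    using assms by (auto simp: ones_vec_def)
  have nth: "(transpose_mat B *\<^sub>v ones_vec n) $ j = (\<Sum>i<n. B $$ (i, j))" if "j < n" for j
    using assms that by (subst mult_mat_vec_nth[OF T e]) (auto simp: ones_vec_def)
  have "transpose_mat B *\<^sub>v ones_vec n = ones_vec n
      \<longleftrightarrow> (\<forall>j<n. (transpose_mat B *\<^sub>v ones_vec n) $ j = ones_vec n $ j)"
    using assms by (auto simp: vec_eq_iff ones_vec_def simp del: index_mult_mat_vec)
  also have "\<dots> \<longleftrightarrow> (\<forall>j<n. (\<Sum>i<n. B $$ (i, j)) = 1)"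
    using nth by (simp add: ones_vec_def)
  finally show ?thesis
    using assms by (simp add: weakly_stochastic_def)
qed

lemma left_fixed_pow:
  assumes A: "A \<in> carrier_mat n n"
    and y: "\<And>j. j < n \<Longrightarrow> (\<Sum>i<n. y i * A $$ (i, j)) = (y j :: 'a :: comm_semiring_1)"
    and "j < n"
  shows "(\<Sum>i<n. y i * (A ^\<^sub>m k) $$ (i, j)) = y j"
  using \<open>j < n\<close>
proof (induction k arbitrary: j)
  case 0
  then show ?case
    using A by (simp add: if_distrib[of "(*) _"] cong: if_cong)
next
  case (Suc k)
  have P: "A ^\<^sub>m k \<in> carrier_mat n n"
    using A by simp
  have "(\<Sum>i<n. y i * (A ^\<^sub>m Suc k) $$ (i, j))
      = (\<Sum>i<n. \<Sum>l<n. y i * (A ^\<^sub>m k) $$ (i, l) * A $$ (l, j))"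
    unfolding pow_mat.simps using Suc.prems
    by (intro sum.cong refl) (simp add: mult_mat_nth[OF P A] sum_distrib_left mult.assoc)
  also have "\<dots> = (\<Sum>l<n. (\<Sum>i<n. y i * (A ^\<^sub>m k) $$ (i, l)) * A $$ (l, j))"
    by (subst sum.swap) (simp add: sum_distrib_right)
  also have "\<dots> = y j"
    using Suc y by simp
  finally show ?case .
qed

lemma weakly_stochastic_pow:
  assumes A: "A \<in> carrier_mat n n" and st: "weakly_stochastic A"
  shows "weakly_stochastic (A ^\<^sub>m k)"
  using left_fixed_pow[OF A, of "\<lambda>_. 1"] st A
  by (simp add: weakly_stochastic_iff[of _ n])

lemma eigenvector_ones:
  assumes "A \<in> carrier_mat n n" "1 \<le> n" "weakly_stochastic A"
  shows "eigenvector (transpose_mat A) (ones_vec n) 1"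
proof -
  have "ones_vec n $ 0 \<noteq> 0"
    using assms by (simp add: ones_vec_def)
  then have "ones_vec n \<noteq> 0\<^sub>v n"
    using assms(2) by auto
  then show ?thesis
    using assms by (auto simp: eigenvector_def weakly_stochastic_def ones_vec_def)
qed

text \<open>Summing the entrywise estimate \<open>\<bar>\<mu>\<bar> \<bar>v\<bar> \<le> B \<bar>v\<bar>\<close> over all rows replaces \<open>B\<close> by its column
sums, which are 1.\<close>
lemma stochastic_norm_eigenvalue_le_1:
  assumes B: "B \<in> carrier_mat n n" and nn: "nonneg_mat B" and st: "weakly_stochastic B"
    and v: "eigenvector B v \<mu>"
  shows "cmod \<mu> \<le> 1"
proof -
  have ev: "(\<Sum>j<n. B $$ (i, j) * v $ j) = \<mu> * v $ i" if "i < n" for i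
    using v that by (simp add: eigenvector_iff_nth[OF B])
  have re: "cmod (B $$ (i, j)) = Re (B $$ (i, j))" if "i < n" "j < n" for i j
    using nn that by (simp add: nonneg_mat_iff[OF B] less_eq_complex_def cmod_eq_Re)
  let ?s = "\<Sum>i<n. cmod (v $ i)"
  have "cmod \<mu> * ?s = (\<Sum>i<n. cmod (\<Sum>j<n. B $$ (i, j) * v $ j))"
    using ev by (simp add: norm_mult sum_distrib_left)
  also have "\<dots> \<le> (\<Sum>i<n. \<Sum>j<n. cmod (B $$ (i, j) * v $ j))"
    by (intro sum_mono norm_sum)
  also have "\<dots> = (\<Sum>j<n. Re (\<Sum>i<n. B $$ (i, j)) * cmod (v $ j))"
    by (subst sum.swap) (simp add: norm_mult re sum_distrib_right)
  also have "\<dots> = ?s"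
    using st by (simp add: weakly_stochastic_iff[OF B])
  finally have "cmod \<mu> * ?s \<le> 1 * ?s" by simp
  moreover have "0 < ?s"
    using v by (auto simp: eigenvector_iff_nth[OF B] intro: sum_pos2)
  ultimately show ?thesis
    by (simp add: mult_le_cancel_right)
qed

text \<open>The all-ones vector is a left eigenvector for 1, and an eigenvalue \<open>l\<close> of \<open>A\<close> satisfies
\<open>\<bar>l\<bar>\<^sup>k \<le> 1\<close> for a \<open>k \<ge> 1\<close> such that \<open>A\<^sup>k\<close> is nonnegative.\<close>
lemma spectral_radius_weakly_stochastic:
  assumes A: "A \<in> carrier_mat n n" and n: "1 \<le> n"
    and st: "weakly_stochastic A" and pn: "power_nonneg A"
  shows "1 \<in> spectrum A" "spectral_radius A = 1"
proof -
  have "eigenvalue (transpose_mat A) 1"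
    using eigenvector_ones[OF A n st] by (auto simp: eigenvalue_def)
  then show one: "1 \<in> spectrum A"
    using A by (simp add: spectrum_def eigenvalue_root_char_poly[of _ n])
  obtain k where k: "1 \<le> k" "nonneg_mat (A ^\<^sub>m k)"
    using pn by (auto simp: power_nonneg_def)
  have "cmod l \<le> 1" if "l \<in> spectrum A" for l
  proof -
    obtain v where v: "eigenvector A v l"
      using \<open>l \<in> spectrum A\<close> by (auto simp: spectrum_def eigenvalue_def)
    have "eigenvector (A ^\<^sub>m k) v (l ^ k)"
      using v eigenvector_pow[OF A v] A by (simp add: eigenvector_def pow_mat_dim_square)
    then have "cmod (l ^ k) \<le> 1"
      using A k weakly_stochastic_pow[OF A st] stochastic_norm_eigenvalue_le_1[of "A ^\<^sub>m k" n]
      by simp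
    then show ?thesis
      using k(1) by (simp add: norm_power power_le_one_iff)
  qed
  then show "spectral_radius A = 1"
    unfolding spectral_radius_def using one card_finite_spectrum(1)[OF A]
    by (intro Max_eqI) (auto intro: rev_image_eqI)
qed

text \<open>If \<open>Z\<close> were a proper closed set with \<open>k\<close> elements, a permutation that moves \<open>Z\<close> to the first
\<open>k\<close> positions would produce a zero upper right block.\<close>
lemma irreducible_mat_closed_set:
  assumes B: "B \<in> carrier_mat n n" and irr: "irreducible_mat B"
    and Z: "Z \<subseteq> {..<n}" "Z \<noteq> {}"
    and zero: "\<And>i j. i \<in> Z \<Longrightarrow> j \<in> {..<n} - Z \<Longrightarrow> B $$ (i, j) = 0"
  shows "Z = {..<n}"
proof (rule ccontr)
  assume ne: "Z \<noteq> {..<n}"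
  have fin: "finite Z"
    using Z finite_subset by blast
  define k where "k = card Z"
  have k0: "0 < k"
    using Z fin by (simp add: k_def card_gt_0_iff)
  have kn: "k < n"
    using psubset_card_mono[of "{..<n}" Z] Z ne by (auto simp: k_def)
  obtain f where f: "bij_betw f {..<k} Z"
    using fin ex_bij_betw_nat_finite[of Z] by (auto simp: k_def lessThan_atLeast0)
  have "card {k..<n} = card ({..<n} - Z)"
    using Z fin by (simp add: card_Diff_subset k_def)
  then obtain g where g: "bij_betw g {k..<n} ({..<n} - Z)"
    using finite_same_card_bij[of "{k..<n}" "{..<n} - Z"] by auto
  define p where "p i = (if i < k then f i else if i < n then g i else i)" for i
  have pf: "bij_betw p {..<k} Z"
    using f by (subst bij_betw_cong[of _ p f]) (auto simp: p_def)
  have pg: "bij_betw p {k..<n} ({..<n} - Z)"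
    using g by (subst bij_betw_cong[of _ p g]) (auto simp: p_def)
  have "bij_betw p ({..<k} \<union> {k..<n}) (Z \<union> ({..<n} - Z))"
    by (rule bij_betw_combine[OF pf pg]) auto
  moreover have "{..<k} \<union> {k..<n} = {..<n}" "Z \<union> ({..<n} - Z) = {..<n}"
    using kn Z by auto
  ultimately have p: "p permutes {..<n}"
    by (intro bij_imp_permutes) (auto simp: p_def k_def kn)
  define P :: "complex mat" where "P = mat n n (\<lambda>(i, j). if j = p i then 1 else 0)"
  have P: "P \<in> carrier_mat n n"
    by (simp add: P_def)
  have p_lt: "p i < n" if "i < n" for i
    using p that permutes_in_image[OF p, of i] by simp
  have PBP: "(P * B * transpose_mat P) $$ (i, j) = B $$ (p i, p j)" if ij: "i < n" "j < n" for i j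
  proof -
    have PB: "(P * B) $$ (i, l) = B $$ (p i, l)" if "l < n" for l
      using ij that p_lt
      by (simp add: mult_mat_nth[OF P B]) (simp add: P_def if_distrib[of "\<lambda>x. x * _"] cong: if_cong)
    have "(P * B * transpose_mat P) $$ (i, j) = (\<Sum>l<n. (P * B) $$ (i, l) * transpose_mat P $$ (l, j))"
      using P B ij by (intro mult_mat_nth) auto
    also have "\<dots> = (\<Sum>l<n. B $$ (p i, l) * (if l = p j then 1 else 0))"
      using ij P by (intro sum.cong refl) (simp add: PB, simp add: P_def)
    also have "\<dots> = B $$ (p i, p j)"
      using ij p_lt by (simp add: if_distrib[of "(*) _"] cong: if_cong)
    finally show ?thesis .
  qed
  define M where "M = P * B * transpose_mat P"
  have M: "M \<in> carrier_mat n n"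
    using P B by (simp add: M_def)
  obtain X Y W V where sb: "split_block M k k = (X, Y, W, V)"
    by (cases "split_block M k k")
  have dims: "dim_row M = k + (n - k)" "dim_col M = k + (n - k)"
    using M kn by auto
  note blocks = split_block[OF sb dims]
  have "Y = 0\<^sub>m k (n - k)"
  proof (rule eq_matI)
    fix i j assume ij: "i < dim_row (0\<^sub>m k (n - k) :: complex mat)" "j < dim_col (0\<^sub>m k (n - k) :: complex mat)"
    then have "Y $$ (i, j) = M $$ (i, j + k)"
      using sb M by (auto simp: split_block_def Let_def)
    also have "\<dots> = B $$ (p i, p (j + k))"
      using ij kn PBP by (simp add: M_def)
    also have "\<dots> = 0"
      using ij bij_betwE[OF pf] bij_betwE[OF pg] by (intro zero) auto
    finally show "Y $$ (i, j) = (0\<^sub>m k (n - k)) $$ (i, j)"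
      using ij by simp
  qed (use blocks in auto)
  moreover have "permutation_mat n P"
    using p by (auto simp: permutation_mat_def P_def)
  ultimately have "reducible_mat B"
    unfolding reducible_mat_def using blocks k0 kn B
    by (intro exI[of _ k] exI[of _ "n - k"] exI[of _ P] exI[of _ X] exI[of _ W] exI[of _ V])
       (simp add: M_def)
  then show False
    using irr by (simp add: irreducible_mat_def)
qed

section \<open>Similarity arguments\<close>

text \<open>Conjugation with a matrix whose first row consists of ones (\<open>S\<close> below) deflates the left
eigenvector of ones: the first row of \<open>S A S\<^sup>-\<^sup>1\<close> becomes \<open>(l, 0, \<dots>, 0)\<close>, so \<open>X - l\<close> splits off
the characteristic polynomial. If \<open>l\<close> were also an eigenvalue of the remaining diagonal block,
its eigenvector, extended by a first entry 0, would come from an eigenvector of \<open>A\<close> with entry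
sum 0.\<close>
lemma simple_eigenvalue_column_sums:
  assumes A: "A \<in> carrier_mat n n" and n: "1 \<le> n"
    and col: "\<And>j. j < n \<Longrightarrow> (\<Sum>i<n. A $$ (i, j)) = l"
    and ev: "\<And>v. eigenvector A v l \<Longrightarrow> (\<Sum>i<n. v $ i) \<noteq> 0"
  shows "simple_eigenvalue A l"
proof -
  obtain k where n_eq: "n = Suc k"
    using n by (cases n) auto
  define S :: "complex mat" where "S = mat n n (\<lambda>(i, j). if i = 0 \<or> i = j then 1 else 0)"
  (* T is the inverse of S. *)
  define T :: "complex mat" where
    "T = mat n n (\<lambda>(i, j). if i = j then 1 else if i = 0 then - 1 else 0)"
  have S: "S \<in> carrier_mat n n" and T: "T \<in> carrier_mat n n"
    by (auto simp: S_def T_def)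
  have S0: "(\<Sum>i<n. z i) = (\<Sum>i<n. S $$ (0, i) * z i)" for z :: "nat \<Rightarrow> complex"
    using n by (simp add: S_def)
  have ST: "S * T = 1\<^sub>m n"
  proof (rule eq_matI)
    fix i j assume "i < dim_row (1\<^sub>m n :: complex mat)" "j < dim_col (1\<^sub>m n :: complex mat)"
    then have ij: "i < n" "j < n" by auto
    have "(S * T) $$ (i, j) = (\<Sum>l<n. S $$ (i, l) * T $$ (l, j))"
      by (rule mult_mat_nth[OF S T ij])
    also have "\<dots> = (1\<^sub>m n :: complex mat) $$ (i, j)"
    proof (cases "i = 0")
      case True
      have "(\<Sum>l<n. S $$ (i, l) * T $$ (l, j))
          = (\<Sum>l<n. (if l = j then 1 else 0) - (if l = 0 then if j = 0 then 0 else 1 else 0))"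
        using True ij by (intro sum.cong refl) (auto simp: S_def T_def)
      also have "\<dots> = 1 - (if j = 0 then 0 else 1)"
        using ij by (simp add: sum_subtractf)
      finally show ?thesis
        using True ij by simp
    next
      case False
      have "(\<Sum>l<n. S $$ (i, l) * T $$ (l, j)) = (\<Sum>l<n. if l = i then T $$ (i, j) else 0)"
        using False ij by (intro sum.cong refl) (auto simp: S_def)
      then show ?thesis
        using False ij by (simp add: T_def)
    qed
    finally show "(S * T) $$ (i, j) = (1\<^sub>m n) $$ (i, j)" .
  qed (use S T in auto)
  have TS: "T * S = 1\<^sub>m n"
    by (rule mat_mult_left_right_inverse[OF S T ST])
  define M where "M = S * A * T"
  have M: "M \<in> carrier_mat n n"
    using S T A by (simp add: M_def)
  have M0: "M $$ (0, j) = (if j = 0 then l else 0)" if j: "j < n" for j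
  proof -
    have SA: "S * A \<in> carrier_mat n n"
      using S A by simp
    have "M $$ (0, j) = (\<Sum>i<n. l * T $$ (i, j))"
      unfolding M_def using mult_mat_nth[OF SA T] mult_mat_nth[OF S A] j n col by (simp flip: S0)
    also have "\<dots> = l * (S * T) $$ (0, j)"
      using mult_mat_nth[OF S T] j n by (simp flip: S0 add: sum_distrib_left)
    finally show ?thesis
      using j n by (simp add: ST)
  qed
  obtain A1 A2 A3 A4 where sb: "split_block (transpose_mat M) 1 1 = (A1, A2, A3, A4)"
    by (cases "split_block (transpose_mat M) 1 1")
  have dims: "dim_row (transpose_mat M) = 1 + k" "dim_col (transpose_mat M) = 1 + k"
    using M n_eq by auto
  note blocks = split_block[OF sb dims]
  have A3: "A3 = 0\<^sub>m k 1"
    using sb M M0 n_eq by (intro eq_matI) (auto simp: split_block_def Let_def)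
  have A1: "char_poly A1 = [:- l, 1:]"
    using sb M M0 n_eq blocks(1)
    by (subst char_poly_upper_triangular[of _ 1])
       (auto simp: split_block_def Let_def diag_mat_def)
  have "similar_mat M A"
    unfolding similar_mat_def
    by (intro exI, rule similar_mat_witI[OF ST TS M_def M A S T])
  then have "char_poly A = char_poly M"
    using char_poly_similar by metis
  also have "\<dots> = char_poly (transpose_mat M)"
    using M by simp
  also have "\<dots> = [:- l, 1:] * char_poly A4"
    using char_poly_four_block_zeros_col[OF blocks(1,2,4)] blocks(5) A1 A3 by simp
  finally have cp: "char_poly A = [:- l, 1:] * char_poly A4" .
  have no_root: "poly (char_poly A4) l \<noteq> 0"
  proof
    assume "poly (char_poly A4) l = 0"
    define D where "D = transpose_mat A4"
    have D: "D \<in> carrier_mat k k"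
      using blocks by (simp add: D_def)
    have D_nth: "D $$ (i, j) = M $$ (Suc i, Suc j)" if "i < k" "j < k" for i j
      using sb M that n_eq by (auto simp: D_def split_block_def Let_def)
    have "eigenvalue D l"
      using \<open>poly (char_poly A4) l = 0\<close> D blocks
      by (simp add: eigenvalue_root_char_poly[OF D]) (simp add: D_def)
    then obtain u where u: "eigenvector D u l"
      by (auto simp: eigenvalue_def)
    note u' = u[unfolded eigenvector_iff_nth[OF D]]
    define z where "z = vec n (\<lambda>i. if i = 0 then 0 else u $ (i - 1))"
    have z: "z \<in> carrier_vec n"
      by (simp add: z_def)
    have z_nth: "z $ 0 = 0" "\<And>i. i < k \<Longrightarrow> z $ Suc i = u $ i"
      by (auto simp: z_def n_eq)
    have Mz: "eigenvector M z l"
      unfolding eigenvector_iff_nth[OF M]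
    proof (intro conjI allI impI z)
      show "\<exists>i<n. z $ i \<noteq> 0"
        using u' z_nth n_eq by auto
      fix i assume i: "i < n"
      show "(\<Sum>j<n. M $$ (i, j) * z $ j) = l * z $ i"
      proof (cases i)
        case 0
        then show ?thesis
          using M0 z_nth n by (auto simp: if_distrib[of "\<lambda>x. x * _"] cong: if_cong)
      next
        case (Suc i')
        then show ?thesis
          using i u' D_nth z_nth unfolding n_eq sum.lessThan_Suc_shift by simp
      qed
    qed
    define v where "v = T *\<^sub>v z"
    have v: "v \<in> carrier_vec n"
      using T z by (simp add: v_def)
    have Sv: "S *\<^sub>v v = z"
      using z by (simp add: v_def ST flip: assoc_mult_mat_vec[OF S T z])
    have "T * M = (T * S) * (A * T)"
      using S T A by (simp add: M_def assoc_mult_mat[of _ n n _ n _ n])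
    also have "\<dots> = A * T"
      using A T by (simp add: TS)
    finally have TM: "T * M = A * T" .
    have "A *\<^sub>v v = (T * M) *\<^sub>v z"
      by (simp only: TM v_def assoc_mult_mat_vec[OF A T z])
    also have "\<dots> = T *\<^sub>v (M *\<^sub>v z)"
      by (rule assoc_mult_mat_vec[OF T M z])
    also have "\<dots> = l \<cdot>\<^sub>v v"
      using Mz M T z by (simp add: eigenvector_def v_def mult_mat_vec)
    finally have "A *\<^sub>v v = l \<cdot>\<^sub>v v" .
    moreover have "v \<noteq> 0\<^sub>v n"
      using Mz M Sv S by (auto simp: eigenvector_def)
    ultimately have "eigenvector A v l"
      using v A by (simp add: eigenvector_def)
    moreover have "(\<Sum>i<n. v $ i) = z $ 0"
      using mult_mat_vec_nth[OF S v, of 0] n by (simp add: Sv flip: S0)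
    ultimately show False
      using ev z_nth by metis
  qed
  have "[:- l, 1:] * char_poly A4 \<noteq> 0"
    using no_root by (auto simp only: mult_eq_0_iff pCons_eq_0_iff poly_0 one_neq_zero)
  then have "order l (char_poly A) = order l [:- l, 1:] + order l (char_poly A4)"
    unfolding cp by (rule order_mult)
  also have "order l [:- l, 1:] = 1"
    using order_power_n_n[of l 1] by simp
  finally show ?thesis
    using no_root by (simp add: simple_eigenvalue_def order_0I)
qed

text \<open>Conjugation with a positive diagonal matrix multiplies each entry of every power by a positive
number, so signs and zeros are preserved.\<close>
lemma diagonal_similarity:
  assumes A: "A \<in> carrier_mat n n" and x: "\<And>i. i < n \<Longrightarrow> 0 < (x i :: complex)"
  obtains R where "R \<in> carrier_mat n n" "similar_mat A R"
    "\<And>i j. i < n \<Longrightarrow> j < n \<Longrightarrow> R $$ (i, j) = inverse (x i) * A $$ (i, j) * x j"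
    "\<And>k. nonneg_mat (R ^\<^sub>m k) \<longleftrightarrow> nonneg_mat (A ^\<^sub>m k)"
proof -
  define E where "E = mat_diag n x"
  define F where "F = mat_diag n (\<lambda>i. inverse (x i))"
  have E: "E \<in> carrier_mat n n" and F: "F \<in> carrier_mat n n"
    by (auto simp: E_def F_def)
  have x0: "x i \<noteq> 0" if "i < n" for i
    using x[OF that] by auto
  have EF: "E * F = 1\<^sub>m n" and FE: "F * E = 1\<^sub>m n"
    using x0 unfolding E_def F_def mat_diag_diag by (auto simp: mat_diag_def intro!: eq_matI)
  define R where "R = F * A * E"
  have R: "R \<in> carrier_mat n n"
    using A E F by (simp add: R_def)
  have conj_nth: "(F * B * E) $$ (i, j) = inverse (x i) * B $$ (i, j) * x j"
    if "B \<in> carrier_mat n n" "i < n" "j < n" for B i j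
    using that by (simp add: E_def F_def mat_diag_mult_left[of _ n n] mat_diag_mult_right[of _ n n])
  have wit: "similar_mat_wit R A F E"
    by (rule similar_mat_witI[OF FE EF R_def R A F E])
  have "nonneg_mat (R ^\<^sub>m k) \<longleftrightarrow> nonneg_mat (A ^\<^sub>m k)" for k
  proof -
    have P: "A ^\<^sub>m k \<in> carrier_mat n n" "R ^\<^sub>m k \<in> carrier_mat n n"
      using A R by auto
    have "0 \<le> inverse (x i) * B * x j \<longleftrightarrow> 0 \<le> B" if ij: "i < n" "j < n" for B i j
    proof -
      obtain a c where "x i = of_real a" "0 < a" and "x j = of_real c" "0 < c"
        using x[OF ij(1)] x[OF ij(2)] by (metis less_complex_def of_real_Re complex_is_Real_iff zero_complex.sel)
      then have "inverse (x i) * B * x j = of_real (c / a) * B" "0 < c / a"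
        by (simp_all add: field_simps)
      then obtain r where "inverse (x i) * B * x j = of_real r * B" "0 < r"
        by blast
      then show ?thesis
        by (simp only: less_eq_complex_def Re_complex_of_real Im_complex_of_real times_complex.sel)
           (auto simp: zero_le_mult_iff)
    qed
    moreover have "(R ^\<^sub>m k) $$ (i, j) = inverse (x i) * (A ^\<^sub>m k) $$ (i, j) * x j"
      if "i < n" "j < n" for i j
      using conj_nth[OF P(1) that] by (simp add: similar_mat_wit_pow_id[OF wit])
    ultimately show ?thesis
      by (simp add: nonneg_mat_iff[OF P(1)] nonneg_mat_iff[OF P(2)])
  qed
  moreover have "similar_mat A R"
    using wit similar_mat_sym unfolding similar_mat_def by blast
  ultimately show thesis
    using conj_nth[OF A] R by (intro that[of R]) (auto simp: R_def)
qed

section \<open>Weakly stochastic roots of irreducible nonnegative matrices\<close>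

locale stochastic_irreducible_power =
  fixes A :: "complex mat" and n m :: nat
  assumes A: "A \<in> carrier_mat n n" and n: "1 \<le> n" and m: "1 \<le> m"
    and stochastic: "weakly_stochastic A"
    and nonneg: "nonneg_mat (A ^\<^sub>m m)"
    and irred: "irreducible_mat (A ^\<^sub>m m)"
begin

abbreviation "B \<equiv> A ^\<^sub>m m"

abbreviation peripheral :: "complex set" where
  "peripheral \<equiv> {l \<in> spectrum A. cmod l = 1}"

lemma B: "B \<in> carrier_mat n n"
  using A by simp

lemma entry_real: "i < n \<Longrightarrow> j < n \<Longrightarrow> of_real (Re (B $$ (i, j))) = B $$ (i, j)"
  using nonneg by (simp add: nonneg_mat_iff[OF B] less_eq_complex_def complex_eq_iff)

lemma entry_nonneg: "i < n \<Longrightarrow> j < n \<Longrightarrow> 0 \<le> Re (B $$ (i, j))"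
  using nonneg by (simp add: nonneg_mat_iff[OF B] less_eq_complex_def)

sublocale kernel: irreducible_kernel "{..<n}" "\<lambda>i j. Re (B $$ (i, j))" "\<lambda>_. 1"
proof
  show "Z = {..<n}"
    if "Z \<subseteq> {..<n}" "Z \<noteq> {}" "\<And>i j. i \<in> Z \<Longrightarrow> j \<in> {..<n} - Z \<Longrightarrow> Re (B $$ (i, j)) = 0" for Z
  proof (rule irreducible_mat_closed_set[OF B irred that(1,2)])
    fix i j assume ij: "i \<in> Z" "j \<in> {..<n} - Z"
    then have "B $$ (i, j) = of_real (Re (B $$ (i, j)))"
      using that(1) by (intro entry_real[symmetric]) auto
    then show "B $$ (i, j) = 0"
      using that(3)[OF ij] by simp
  qed
  show "(\<Sum>i<n. 1 * Re (B $$ (i, j))) = 1" if "j \<in> {..<n}" for j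
    using that weakly_stochastic_pow[OF A stochastic, of m]
    by (simp add: weakly_stochastic_iff[OF B] flip: Re_sum)
qed (auto simp: entry_nonneg)

lemma kernel_eigenfun_iff:
  "kernel.eigenfun \<mu> v \<longleftrightarrow> (\<forall>i<n. (\<Sum>j<n. B $$ (i, j) * v j) = \<mu> * v i)"
proof -
  have "(\<Sum>j<n. of_real (Re (B $$ (i, j))) * v j) = (\<Sum>j<n. B $$ (i, j) * v j)" if "i < n" for i
    using that by (intro sum.cong) (simp_all add: entry_real)
  then show ?thesis
    by (simp add: kernel.eigenfun_def Ball_def)
qed

lemma eigenvector_kernel:
  assumes "eigenvector A v l"
  shows "kernel.eigenfun (l ^ m) (\<lambda>i. v $ i)" "\<exists>i\<in>{..<n}. v $ i \<noteq> 0"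
proof -
  have "eigenvector B v (l ^ m)"
    using assms eigenvector_pow[OF A assms] A by (simp add: eigenvector_def)
  then show "kernel.eigenfun (l ^ m) (\<lambda>i. v $ i)" "\<exists>i\<in>{..<n}. v $ i \<noteq> 0"
    by (auto simp: eigenvector_iff_nth[OF B] kernel_eigenfun_iff)
qed

text \<open>Both vectors are eigenvectors of \<open>A\<^sup>m\<close> for the same eigenvalue of modulus 1.\<close>
lemma eigenvector_unique:
  assumes v: "eigenvector A v l" and u: "eigenvector A u l'"
    and "l ^ m = l' ^ m" "cmod l = 1"
  shows "\<exists>c. u = c \<cdot>\<^sub>v v"
proof -
  obtain c where "\<And>i. i < n \<Longrightarrow> u $ i = c * v $ i"
    using kernel.eigenfun_unique[OF eigenvector_kernel(1)[OF v] _ _ eigenvector_kernel(2)[OF v]]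
      eigenvector_kernel(1)[OF u] assms(3,4) by (metis lessThan_iff norm_power power_one)
  then show ?thesis
    using u v A by (intro exI[of _ c]) (auto simp: eigenvector_def vec_eq_iff)
qed

text \<open>Eigenvectors for \<open>l\<close> and \<open>l'\<close> with the same \<open>m\<close>-th power are proportional, and a vector has only
one eigenvalue.\<close>
lemma inj_on_power_peripheral: "inj_on (\<lambda>l. l ^ m) peripheral"
proof (rule inj_onI)
  fix l l' assume l: "l \<in> peripheral" and l': "l' \<in> peripheral" and eq: "l ^ m = l' ^ m"
  obtain v u where v: "eigenvector A v l" and u: "eigenvector A u l'"
    using l l' by (auto simp: spectrum_def eigenvalue_def)
  obtain c where c: "u = c \<cdot>\<^sub>v v"
    using eigenvector_unique[OF v u eq] l by auto
  have "v \<in> carrier_vec n"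
    using v A by (simp add: eigenvector_def)
  then have "A *\<^sub>v u = l \<cdot>\<^sub>v u"
    using v A by (simp add: c eigenvector_def mult_mat_vec smult_smult_assoc mult.commute)
  then have "eigenvector A u l"
    using u by (simp add: eigenvector_def)
  moreover obtain i where "i < n" "u $ i \<noteq> 0"
    using u by (auto simp: eigenvector_iff_nth[OF A])
  ultimately show "l = l'"
    using u by (auto simp: eigenvector_iff_nth[OF A])
qed

text \<open>The eigenspaces of \<open>A\<^sup>m\<close> for eigenvalues of modulus 1 are lines, and \<open>A\<close> commutes with \<open>A\<^sup>m\<close>.
Hence \<open>A\<close> maps each of these lines into itself and acts on it as a scalar \<open>c\<close>.\<close>
lemma kernel_eigenvalue_lift:
  assumes v: "kernel.eigenfun \<nu> v" "cmod \<nu> = 1" "\<exists>i\<in>{..<n}. v i \<noteq> 0"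
  obtains c where "c \<in> peripheral" "c ^ m = \<nu>"
proof -
  define V where "V = vec n v"
  have V: "V \<in> carrier_vec n"
    by (simp add: V_def)
  have BV: "B *\<^sub>v V = \<nu> \<cdot>\<^sub>v V"
  proof -
    have "eigenvector B V \<nu>"
      using v V by (auto simp: eigenvector_iff_nth[OF B] kernel_eigenfun_iff V_def)
    then show ?thesis
      by (simp add: eigenvector_def)
  qed
  have "B *\<^sub>v (A *\<^sub>v V) = A *\<^sub>v (B *\<^sub>v V)"
  proof -
    (* Powers are formed by multiplication on the right, so this needs an induction. *)
    have "A * A ^\<^sub>m k = A ^\<^sub>m k * A" for k
      by (induction k) (use A in \<open>auto simp flip: assoc_mult_mat[of _ n n _ n _ n]\<close>)
    then show ?thesis
      using A B V by (simp flip: assoc_mult_mat_vec[of _ n n _ n])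
  qed
  then have BAV: "B *\<^sub>v (A *\<^sub>v V) = \<nu> \<cdot>\<^sub>v (A *\<^sub>v V)"
    using A V by (simp add: BV mult_mat_vec)
  have AV: "A *\<^sub>v V \<in> carrier_vec n"
    using A V by simp
  have "(\<Sum>j<n. B $$ (i, j) * (A *\<^sub>v V) $ j) = \<nu> * (A *\<^sub>v V) $ i" if "i < n" for i
    using mult_mat_vec_nth[OF B AV that] that AV A unfolding BAV by simp
  then have "kernel.eigenfun \<nu> (\<lambda>i. (A *\<^sub>v V) $ i)"
    by (simp add: kernel_eigenfun_iff del: index_mult_mat_vec)
  from kernel.eigenfun_unique[OF v(1) this v(2,3)]
  obtain c where "\<And>i. i < n \<Longrightarrow> (A *\<^sub>v V) $ i = c * v i" by auto
  then have "A *\<^sub>v V = c \<cdot>\<^sub>v V"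
    using A V by (auto simp: vec_eq_iff V_def simp del: index_mult_mat_vec)
  moreover have "V \<noteq> 0\<^sub>v n"
    using v(3) by (auto simp: V_def vec_eq_iff)
  ultimately have ev: "eigenvector A V c"
    using A V by (simp add: eigenvector_def)
  have "c ^ m \<cdot>\<^sub>v V = \<nu> \<cdot>\<^sub>v V"
    using eigenvector_pow[OF A ev, of m] BV by simp
  then have "c ^ m = \<nu>"
    using v(3) by (auto simp: vec_eq_iff V_def)
  moreover from this have "cmod c ^ m = 1"
    using v(2) by (simp flip: norm_power)
  then have "cmod c = 1"
    using m power_eq_imp_eq_base[of "cmod c" m 1] by simp
  ultimately show thesis
    using ev by (intro that[of c]) (auto simp: spectrum_def eigenvalue_def)
qed

text \<open>The power map \<open>l \<mapsto> l\<^sup>m\<close> is a bijection from the peripheral eigenvalues of \<open>A\<close> onto those of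
\<open>A\<^sup>m\<close>, and the latter are permuted by multiplication with any one of them. So the exponent
\<open>p\<close> may be taken to be the number of peripheral eigenvalues of \<open>A\<close> itself.\<close>
lemma peripheral_power_eq_1:
  assumes l: "l \<in> peripheral"
  shows "l ^ (card peripheral * m) = 1"
proof -
  define Q where "Q = (\<lambda>l. l ^ m) ` peripheral"
  obtain v where v: "eigenvector A v l"
    using l by (auto simp: spectrum_def eigenvalue_def)
  have closed: "l ^ m * q \<in> Q" if q: "q \<in> Q" for q
  proof -
    obtain l' where l': "l' \<in> peripheral" "q = l' ^ m"
      using q by (auto simp: Q_def)
    obtain u where u: "eigenvector A u l'"
      using l' by (auto simp: spectrum_def eigenvalue_def)
    have "kernel.eigenfun (l ^ m * q) (\<lambda>i. sgn (v $ i) * u $ i)"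
      using kernel.eigenfun_twist[OF eigenvector_kernel(1)[OF v] _ eigenvector_kernel(2)[OF v]
          eigenvector_kernel(1)[OF u]] l l' by (simp add: norm_power)
    moreover have "\<exists>i\<in>{..<n}. sgn (v $ i) * u $ i \<noteq> 0"
      using kernel.eigenfun_nonzero[OF eigenvector_kernel(1)[OF v] _ eigenvector_kernel(2)[OF v]]
        eigenvector_kernel(2)[OF u] l by (auto simp: norm_power sgn_zero_iff)
    moreover have "cmod (l ^ m * q) = 1"
      using l l' by (simp add: norm_mult norm_power)
    ultimately obtain c where "c \<in> peripheral" "c ^ m = l ^ m * q"
      using kernel_eigenvalue_lift[of "l ^ m * q" "\<lambda>i. sgn (v $ i) * u $ i"] by blast
    then show ?thesis
      by (auto simp: Q_def intro: rev_image_eqI)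
  qed
  have "(l ^ m) ^ card Q = 1"
  proof (rule power_card_eq_1[OF _ _ _ closed])
    show "finite Q"
      using card_finite_spectrum(1)[OF A] by (simp add: Q_def)
    show "0 \<notin> Q" "l ^ m \<noteq> 0"
      using l by (auto simp: Q_def)
  qed
  moreover have "card Q = card peripheral"
    unfolding Q_def by (rule card_image[OF inj_on_power_peripheral])
  ultimately show ?thesis
    by (simp add: mult.commute flip: power_mult)
qed

text \<open>The diagonal entries of \<open>b D = \<mu> D b\<close>, for \<open>\<mu> = l\<^sup>m\<close>, say that
\<open>b i i = \<mu> * b i i\<close>, once the nonzero phase of \<open>v i\<close> is cancelled.\<close>
lemma diagonal_entry_pos_imp:
  assumes l: "l \<in> peripheral" and i: "i < n" "0 < B $$ (i, i)"
  shows "l ^ m = 1"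
proof -
  obtain v where v: "eigenvector A v l"
    using l by (auto simp: spectrum_def eigenvalue_def)
  have \<mu>: "cmod (l ^ m) = 1"
    using l by (simp add: norm_power)
  have "v $ i \<noteq> 0"
    using kernel.eigenfun_nonzero[OF eigenvector_kernel(1)[OF v] \<mu> eigenvector_kernel(2)[OF v]] i
    by simp
  moreover have "B $$ (i, i) * sgn (v $ i) = l ^ m * sgn (v $ i) * B $$ (i, i)"
    using kernel.eigenfun_phase[OF eigenvector_kernel(1)[OF v] \<mu> eigenvector_kernel(2)[OF v], of i i] i
    by (simp add: entry_real)
  moreover have "B $$ (i, i) \<noteq> 0"
    using i by auto
  ultimately show ?thesis
    by (simp add: sgn_zero_iff)
qed

lemma one_eigenvalue: "1 \<in> peripheral"
proof -
  have "power_nonneg A"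
    using A m nonneg by (auto simp: power_nonneg_def)
  then show ?thesis
    using spectral_radius_weakly_stochastic(1)[OF A n stochastic] by simp
qed

lemma peripheral_root_unique:
  assumes "l \<in> peripheral" "l ^ m = 1"
  shows "l = 1"
  using inj_onD[OF inj_on_power_peripheral, of l 1] assms one_eigenvalue by simp

text \<open>An eigenvector of \<open>A\<close> for 1 spans the same line as the vector of its moduli, which is positive.\<close>
lemma positive_eigenvector:
  obtains x where "eigenvector A x 1" "positive_vec x"
proof -
  obtain v where v: "eigenvector A v 1"
    using one_eigenvalue by (auto simp: spectrum_def eigenvalue_def)
  have ev: "kernel.eigenfun 1 (\<lambda>i. v $ i)"
    using eigenvector_kernel(1)[OF v] by simp
  obtain c where c: "\<And>i. i < n \<Longrightarrow> c * v $ i = of_real (cmod (v $ i))"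
    using kernel.eigenfun_positive[OF ev eigenvector_kernel(2)[OF v]] by auto
  have nz: "v $ i \<noteq> 0" if "i < n" for i
    using kernel.eigenfun_nonzero[OF ev _ eigenvector_kernel(2)[OF v]] that by simp
  have v': "v \<in> carrier_vec n" "A *\<^sub>v v = v"
    using v A by (auto simp: eigenvector_def)
  show thesis
  proof (rule that[of "c \<cdot>\<^sub>v v"])
    show pos: "positive_vec (c \<cdot>\<^sub>v v)"
      using v' c nz by (auto simp: positive_vec_def less_complex_def)
    then have "(c \<cdot>\<^sub>v v) $ 0 \<noteq> 0"
      using v' n by (auto simp: positive_vec_def)
    then have "c \<cdot>\<^sub>v v \<noteq> 0\<^sub>v n"
      using n by auto
    then show "eigenvector A (c \<cdot>\<^sub>v v) 1"
      using v' A by (simp add: eigenvector_def mult_mat_vec)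
  qed
qed

text \<open>The transpose of \<open>A\<^sup>m\<close> satisfies the same hypotheses with the Perron vector \<open>x\<close> as its left
eigenvector, so its eigenspace for 1 is a line as well.\<close>
lemma left_eigenvector_unique:
  assumes y: "eigenvector (transpose_mat A) y 1"
  shows "\<exists>c. y = c \<cdot>\<^sub>v ones_vec n"
proof -
  obtain x where x: "eigenvector A x 1" and pos: "positive_vec x"
    by (rule positive_eigenvector)
  have dim: "dim_vec x = n"
    using x A by (auto simp: eigenvector_def)
  have Bx: "(\<Sum>j<n. B $$ (i, j) * x $ j) = x $ i" if "i < n" for i
    using eigenvector_kernel(1)[OF x] that by (simp add: kernel_eigenfun_iff)
  have x_real: "Im (x $ i) = 0" if "i < n" for i
    using pos that dim by (simp add: positive_vec_def less_complex_def)
  (* A closed set for the transpose is the complement of a closed set for the matrix. *)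
  interpret dual: irreducible_kernel "{..<n}" "\<lambda>i j. Re (B $$ (j, i))" "\<lambda>i. Re (x $ i)"
  proof
    show "Z = {..<n}"
      if Z: "Z \<subseteq> {..<n}" "Z \<noteq> {}" "\<And>i j. i \<in> Z \<Longrightarrow> j \<in> {..<n} - Z \<Longrightarrow> Re (B $$ (j, i)) = 0" for Z
    proof (rule ccontr)
      assume "Z \<noteq> {..<n}"
      then have "{..<n} - Z = {..<n}"
        using Z by (intro kernel.irreducible) auto
      then show False
        using Z(1,2) by auto
    qed
    show "0 < Re (x $ i)" if "i \<in> {..<n}" for i
      using pos that dim by (auto simp: positive_vec_def less_complex_def)
    show "(\<Sum>i<n. Re (x $ i) * Re (B $$ (j, i))) = Re (x $ j)" if "j \<in> {..<n}" for j
    proof -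
      have "(\<Sum>i<n. Re (x $ i) * Re (B $$ (j, i))) = Re (\<Sum>i<n. B $$ (j, i) * x $ i)"
        using x_real by (auto intro!: sum.cong)
      then show ?thesis
        using that by (simp only: Bx lessThan_iff)
    qed
  qed (auto simp: entry_nonneg)
  have T: "transpose_mat A \<in> carrier_mat n n"
    using A by simp
  have eigen: "dual.eigenfun 1 z" if "\<And>j. j < n \<Longrightarrow> (\<Sum>i<n. z i * A $$ (i, j)) = z j" for z
    unfolding dual.eigenfun_def
    using left_fixed_pow[OF A that, where k = m] entry_real by (simp add: mult.commute)
  have "(\<Sum>i<n. y $ i * A $$ (i, j)) = y $ j" if "j < n" for j
    using y that A by (simp add: eigenvector_iff_nth[OF T] mult.commute)
  then have y': "dual.eigenfun 1 (\<lambda>i. y $ i)"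
    by (rule eigen)
  have one: "dual.eigenfun 1 (\<lambda>_. 1)"
    using stochastic by (intro eigen) (simp add: weakly_stochastic_iff[OF A])
  obtain c where "\<And>i. i < n \<Longrightarrow> y $ i = c * 1"
    using dual.eigenfun_unique[OF one y'] n by auto
  moreover have "dim_vec y = n"
    using y A by (auto simp: eigenvector_def)
  ultimately show ?thesis
    by (intro exI[of _ c]) (auto simp: vec_eq_iff ones_vec_def)
qed

text \<open>Every right eigenvector for 1 is a multiple of a positive vector, so its entries cannot add up
to 0.\<close>
lemma simple_one: "simple_eigenvalue A 1"
proof (rule simple_eigenvalue_column_sums[OF A n])
  show "(\<Sum>i<n. A $$ (i, j)) = 1" if "j < n" for j
    using stochastic that by (simp add: weakly_stochastic_iff[OF A])
  fix v assume v: "eigenvector A v 1"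
  obtain x where x: "eigenvector A x 1" and pos: "positive_vec x"
    by (rule positive_eigenvector)
  obtain c where c: "x = c \<cdot>\<^sub>v v"
    using eigenvector_unique[OF v x] by auto
  have dim: "dim_vec x = n" "dim_vec v = n"
    using x v A by (auto simp: eigenvector_def)
  have "0 < (\<Sum>i<n. Re (x $ i))"
    using pos dim n by (intro sum_pos) (auto simp: positive_vec_def less_complex_def lessThan_empty_iff)
  then have "(\<Sum>i<n. x $ i) \<noteq> 0"
    by (metis Re_sum less_irrefl zero_complex.sel(1))
  moreover have "(\<Sum>i<n. x $ i) = c * (\<Sum>i<n. v $ i)"
    using dim by (simp add: c sum_distrib_left)
  ultimately show "(\<Sum>i<n. v $ i) \<noteq> 0"
    by auto
qed

lemma lambda1_eq_1: "lambda1 A m = 1"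
proof -
  have "spectral_radius A = 1"
    using spectral_radius_weakly_stochastic(2)[OF A n stochastic] A m nonneg
    by (auto simp: power_nonneg_def)
  then show ?thesis
    unfolding lambda1_def using one_eigenvalue peripheral_root_unique
    by (intro the_equality) auto
qed

end

section \<open>Power nonnegative weakly stochastic matrices\<close>

text \<open>The range of \<open>h\<close> is \<open>1, \<dots>, N\<close>, so the root 1 is represented by \<open>h = N\<close>.\<close>
lemma root_of_unity_exp:
  fixes z :: complex
  assumes N: "1 \<le> N" and z: "z ^ N = 1"
  shows "\<exists>h::int. 1 \<le> h \<and> h \<le> int N \<and> z = exp (2 * of_real pi * \<i> * of_int h / of_nat N)"
proof -
  obtain k where k: "k < N" "z = cis (2 * pi * real k / real N)"
    using bij_betw_roots_unity[of N] N z by (auto simp: bij_betw_def)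
  have z_eq: "z = exp (2 * of_real pi * \<i> * of_int (int k) / of_nat N)"
    using k by (simp add: cis_conv_exp mult_ac)
  show ?thesis
  proof (cases "k = 0")
    case True
    then have "z = exp (2 * of_real pi * \<i> * of_int (int N) / of_nat N)"
      using z_eq N by simp
    then show ?thesis
      using N by (intro exI[of _ "int N"]) auto
  next
    case False
    then show ?thesis
      using z_eq k by (intro exI[of _ "int k"]) auto
  qed
qed

lemma nu_eqI:
  assumes "\<And>k. nonneg_mat (R ^\<^sub>m k) \<longleftrightarrow> nonneg_mat (A ^\<^sub>m k)"
  shows "nu R = nu A"
  by (simp add: nu_def assms)

theorem corollary4p10:
  fixes A :: "complex mat" and n :: nat
  assumes "n \<ge> 1"
    and "A \<in> carrier_mat n n"
    and "weakly_stochastic A"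
    and "power_nonneg A"
  shows "spectral_radius A = 1 \<and> complex_of_real (spectral_radius A) \<in> spectrum A \<and>
    (\<forall>m \<ge> nu A. nonneg_mat (A ^\<^sub>m m) \<and> irreducible_mat (A ^\<^sub>m m) \<longrightarrow>
       \<comment> \<open>e is a left eigenvector\<close>
       eigenvector (transpose_mat A) (ones_vec n) (lambda1 A m) \<and>
       \<comment> \<open>(ii)\<close>
       (simple_eigenvalue A (lambda1 A m) \<and> lambda1 A m \<noteq> 0 \<and>
        (complex_of_real (spectral_radius A) \<in> spectrum A \<longleftrightarrow>
           lambda1 A m = complex_of_real (spectral_radius A))) \<and>
       \<comment> \<open>(iii)\<close>
       ((\<exists>x. eigenvector A x (lambda1 A m) \<and> positive_vec x \<and>
           (\<forall>x'. eigenvector A x' (lambda1 A m) \<longrightarrow> (\<exists>c. x' = c \<cdot>\<^sub>v x))) \<and>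
        (\<forall>y. eigenvector (transpose_mat A) y (lambda1 A m) \<longrightarrow>
           (\<exists>c. y = c \<cdot>\<^sub>v ones_vec n))) \<and>
       \<comment> \<open>(iv)\<close>
       ((coprime (nu A) m \<longrightarrow> complex_of_real (spectral_radius A) \<in> spectrum A) \<and>
        (complex_of_real (spectral_radius A) \<notin> spectrum A \<and> (prime (nu A) \<or> prime m) \<longrightarrow>
           nu A \<ge> 1 \<and> nonneg_mat (A ^\<^sub>m nu A) \<and> irreducible_mat (A ^\<^sub>m nu A) \<and>
           (\<forall>k \<ge> 1. nonneg_mat (A ^\<^sub>m k) \<and> irreducible_mat (A ^\<^sub>m k) \<longrightarrow> nu A \<le> k))) \<and>
       \<comment> \<open>(v)\<close>
       (\<exists>C R.
          similar_mat (inverse (lambda1 A m) \<cdot>\<^sub>m A) C \<and> power_nonneg C \<and> weakly_stochastic C \<and>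
          similar_mat (inverse (lambda1 A m) \<cdot>\<^sub>m A) R \<and> power_nonneg R \<and> weakly_row_stochastic R \<and>
          same_pattern C A \<and> same_pattern R A \<and> nu C = nu A \<and> nu R = nu A) \<and>
       \<comment> \<open>(vi)\<close>
       (\<forall>l \<in> spectrum A. cmod l = spectral_radius A \<longrightarrow>
          (let p = card {l \<in> spectrum A. cmod l = spectral_radius A}
           in \<exists>h::int. 1 \<le> h \<and> h \<le> int (p * m) \<and>
                l = complex_of_real (spectral_radius A) *
                    exp (2 * complex_of_real pi * \<i> * of_int h / of_nat (p * m)))) \<and>
       \<comment> \<open>(vii)\<close>
       ((\<exists>i < n. 0 < (A ^\<^sub>m m) $$ (i, i)) \<longrightarrow>
          (\<forall>ls. eigenvalue_listing A m ls \<and> length ls \<ge> 2 \<longrightarrow> cmod (ls ! 0) > cmod (ls ! 1))))"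
    (is "_ \<and> _ \<and> (\<forall>m \<ge> _. _ m \<and> _ m \<longrightarrow> ?P m)")
proof -
  note A = assms(2) and st = assms(3)
  have spec: "1 \<in> spectrum A" "spectral_radius A = 1"
    using spectral_radius_weakly_stochastic[OF A assms(1) st assms(4)] .
  have "1 \<le> nu A"
    using assms(4) unfolding nu_def power_nonneg_def by (metis (mono_tags, lifting) LeastI_ex)
  have main: "?P m" if "nu A \<le> m" "nonneg_mat (A ^\<^sub>m m)" "irreducible_mat (A ^\<^sub>m m)" for m
  proof -
    (* m \<ge> 1, because the index nu A is at least 1. *)
    interpret stochastic_irreducible_power A n m
      using that assms \<open>1 \<le> nu A\<close> by unfold_locales auto
    obtain x where x: "eigenvector A x 1" "positive_vec x"
      by (rule positive_eigenvector)
    have dim: "dim_vec x = n"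
      using x A by (auto simp: eigenvector_def)
    have x_pos: "0 < x $ i" if "i < n" for i
      using x that dim by (simp add: positive_vec_def)
    have right: "\<exists>x. eigenvector A x 1 \<and> positive_vec x \<and>
        (\<forall>x'. eigenvector A x' 1 \<longrightarrow> (\<exists>c. x' = c \<cdot>\<^sub>v x))"
      using x eigenvector_unique[OF x(1)] by auto
    (* A itself serves as C; R is the conjugate of A by the diagonal matrix of its Perron vector. *)
    have similar: "\<exists>C R.
        similar_mat (inverse 1 \<cdot>\<^sub>m A) C \<and> power_nonneg C \<and> weakly_stochastic C \<and>
        similar_mat (inverse 1 \<cdot>\<^sub>m A) R \<and> power_nonneg R \<and> weakly_row_stochastic R \<and>
        same_pattern C A \<and> same_pattern R A \<and> nu C = nu A \<and> nu R = nu A"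
    proof -
      obtain R where R: "R \<in> carrier_mat n n" "similar_mat A R"
        and R_nth: "\<And>i j. i < n \<Longrightarrow> j < n \<Longrightarrow> R $$ (i, j) = inverse (x $ i) * A $$ (i, j) * x $ j"
        and R_pow: "\<And>k. nonneg_mat (R ^\<^sub>m k) \<longleftrightarrow> nonneg_mat (A ^\<^sub>m k)"
        using diagonal_similarity[OF A, of "\<lambda>i. x $ i"] x_pos by blast
      have x0: "x $ i \<noteq> 0" if "i < n" for i
        using x_pos[OF that] by auto
      have "(\<Sum>j<n. R $$ (i, j) * 1) = 1" if i: "i < n" for i
      proof -
        have "(\<Sum>j<n. R $$ (i, j) * 1) = inverse (x $ i) * (\<Sum>j<n. A $$ (i, j) * x $ j)"
          using i by (simp add: R_nth sum_distrib_left mult.assoc)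
        also have "\<dots> = 1"
          using x(1) i x0 by (simp add: eigenvector_iff_nth[OF A])
        finally show ?thesis .
      qed
      moreover have "\<exists>i<n. ones_vec n $ i \<noteq> 0"
        using assms(1) by (intro exI[of _ 0]) (simp add: ones_vec_def)
      ultimately have "eigenvector R (ones_vec n) 1"
        by (simp add: eigenvector_iff_nth[OF R(1)]) (simp add: ones_vec_def)
      then have "weakly_row_stochastic R"
        using R(1) by (auto simp: weakly_row_stochastic_def eigenvector_def)
      moreover have "power_nonneg R"
        using R(1) R_pow assms(4) by (simp add: power_nonneg_def)
      moreover have "same_pattern R A" "same_pattern A A"
        using A R(1) R_nth x0 by (auto simp: same_pattern_def)
      moreover have "inverse 1 \<cdot>\<^sub>m A = A"
        using A by (intro eq_matI) auto
      ultimately show ?thesis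
        using A R(2) assms st nu_eqI[OF R_pow] similar_mat_refl[OF A]
        by (intro exI[of _ A] exI[of _ R]) simp
    qed
    have roots: "\<exists>h::int. 1 \<le> h \<and> h \<le> int (card peripheral * m) \<and>
        l = 1 * exp (2 * complex_of_real pi * \<i> * of_int h / of_nat (card peripheral * m))"
      if "l \<in> peripheral" for l
    proof -
      have "card peripheral \<noteq> 0"
        using one_eigenvalue card_finite_spectrum(1)[OF A] by (auto simp: card_eq_0_iff)
      then have "1 \<le> card peripheral * m"
        using m by (simp add: Suc_le_eq)
      from root_of_unity_exp[OF this peripheral_power_eq_1[OF that]] show ?thesis
        by (simp only: mult_1_left)
    qed
    (* An eigenvalue of modulus 1 in second place would have m-th power 1, hence be equal to the first. *)
    have second: "cmod (ls ! 0) > cmod (ls ! 1)"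
      if i: "i < n" "0 < (A ^\<^sub>m m) $$ (i, i)" and ls: "eigenvalue_listing A m ls" "2 \<le> length ls"
      for i ls
    proof -
      have "ls ! 1 \<in> spectrum A" and ls0: "ls ! 0 = 1"
        using ls lambda1_eq_1 nth_mem[of 1 ls] by (auto simp: eigenvalue_listing_def)
      moreover have "ls ! 1 \<noteq> ls ! 0"
        using ls nth_eq_iff_index_eq[of ls 1 0] by (auto simp: eigenvalue_listing_def)
      ultimately have "cmod (ls ! 1) \<noteq> 1"
        using diagonal_entry_pos_imp[OF _ i] peripheral_root_unique by auto
      moreover have "cmod (ls ! 1) \<le> cmod (ls ! 0)"
        using ls sorted_wrt_nth_less[of "\<lambda>a b. cmod b \<le> cmod a" ls 0 1]
        by (auto simp: eigenvalue_listing_def)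
      ultimately show ?thesis
        using ls0 by simp
    qed
    show ?thesis
      unfolding lambda1_eq_1 spec(2) of_real_1
    proof (intro conjI simple_one right similar)
      show "eigenvector (transpose_mat A) (ones_vec n) 1"
        by (rule eigenvector_ones[OF A assms(1) st])
      show "\<forall>y. eigenvector (transpose_mat A) y 1 \<longrightarrow> (\<exists>c. y = c \<cdot>\<^sub>v ones_vec n)"
        using left_eigenvector_unique by blast
      show "\<forall>l\<in>spectrum A. cmod l = 1 \<longrightarrow> (let p = card peripheral in
          \<exists>h::int. 1 \<le> h \<and> h \<le> int (p * m) \<and>
            l = 1 * exp (2 * complex_of_real pi * \<i> * of_int h / of_nat (p * m)))"
        unfolding Let_def using roots by blast
      show "(\<exists>i<n. 0 < (A ^\<^sub>m m) $$ (i, i)) \<longrightarrow>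
          (\<forall>ls. eigenvalue_listing A m ls \<and> length ls \<ge> 2 \<longrightarrow> cmod (ls ! 0) > cmod (ls ! 1))"
        using second by blast
    qed (use spec(1) in simp_all)
  qed
  have "\<forall>m \<ge> nu A. nonneg_mat (A ^\<^sub>m m) \<and> irreducible_mat (A ^\<^sub>m m) \<longrightarrow> ?P m"
    by (intro allI impI main) auto
  moreover have "complex_of_real (spectral_radius A) \<in> spectrum A"
    using spec by simp
  ultimately show ?thesis
    using spec(2) by (intro conjI)
qed

end
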